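(* Consider a finite-state channel with time-invariant deterministic feedback $z_i=z(y_i)$ and the random ensemble of codes with $M$ messages and block length $N$ generated by $Q(x^N\|z^{N-1})$ as described in the context. Suppose that an arbitrary message $m$, $1\le m\le M$, enters the encoder with feedback and that maximum likelihood decoding is employed. Then the average probability of decoding error over this ensemble of codes is bounded, for any choice of $\rho$, $0<\rho\le1$, by $$\mathbf E(P_{e,m})\le(M-1)^\rho\sum_{y^N}\left[\sum_{x^N}Q(x^N\|z^{N-1})P(y^N\|x^N)^{\frac1{1+\rho}}\right]^{1+\rho},$$ where the expectation is with respect to the randomness in the ensemble.
   Context: Finite-state channel (FSC): finite input, output and state alphabets $\mathcal X,\mathcal Y,\mathcal S$ and a time-invariant kernel $P(y_i,s_i|x_i,s_{i-1})$ with $P(y_i,s_i|x^i,s^{i-1},y^{i-1})=P(y_i,s_i|x_i,s_{i-1})$; the initial state $S_0$ has a given distribution $P(s_0)$ and is independent of the message and code. Notation: $x^i=(x_1,\dots,x_i)$. Feedback: $z:\mathcal Y\to\mathcal Z$ is a fixed function into a finite set, $z_i=z(y_i)$; at time $i$ the encoder knows $z^{i-1}$. In the sums, $z^{N-1}=(z(y_1),\dots,z(y_{N-1}))$. Causal conditioning: $Q(x^N\|z^{N-1})=\prod_{i=1}^N Q(x_i|x^{i-1},z^{i-1})$ for given conditional pmfs $Q(x_i|x^{i-1},z^{i-1})$; $P(y^N\|x^N)=\prod_{i=1}^N P(y_i|x^i,y^{i-1})=\sum_{s_0}P(s_0)\sum_{s^N}\prod_{i=1}^N P(y_i,s_i|x_i,s_{i-1})$.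 Random code: each message $m\in\{1,\dots,M\}$ is assigned, independently of the other messages, a random code-tree $\{x_i(m,z^{i-1})\}$: the first symbol $x_1(m)$ is drawn from $Q(x_1)$, and successively for each $i$ and each possible feedback sequence $z^{i-1}$ the symbol $x_i(m,z^{i-1})$ is drawn from $Q(x_i|x^{i-1},z^{i-1})$, where $x^{i-1}$ is the previously chosen path $x^{i-1}(m,z^{i-2})$. The code is known to the decoder. The maximum likelihood decoder outputs a message $m$ maximizing $P(y^N|m)$, which equals $P(y^N\|x^N)$ with $x^N=x^N(m,z^{N-1}(y^{N-1}))$. $P_{e,m}=\sum_{y^N\in Y_m^c}P(y^N|m)$ is the probability of decoding error when $m$ is sent, where $Y_m^c$ is the set of outputs that cause an error when decoding $m$. *)

theory Defs
  imports "HOL-Probability.Probability" "HOL-Probability.Product_PMF"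
begin

text \<open>
  A finite-state channel is given by a law \<open>p0\<close> of the initial state and a kernel
  \<open>K x s\<close>, the joint law of (output, next state) given the current input \<open>x\<close> and the
  previous state \<open>s\<close>. Sequences are lists; list positions are 0-based, so \<open>xs ! i\<close> is the
  \<open>(i+1)\<close>-st symbol and \<open>take i xs\<close> is the prefix of all symbols before it.

  A code-tree is a function \<open>t\<close> from feedback histories to input symbols: the symbol sent at
  time \<open>i\<close> is \<open>t zs\<close>, where \<open>zs\<close> has length \<open>i - 1\<close>.
  A code assigns a code-tree to each message.
\<close>

type_synonym ('z, 'x) code_tree = "'z list \<Rightarrow> 'x"
type_synonym ('z, 'x) code = "nat \<Rightarrow> ('z, 'x) code_tree"

definition causal_input ::
  "('x list \<Rightarrow> 'z list \<Rightarrow> 'x pmf) \<Rightarrow> 'x list \<Rightarrow> 'z list \<Rightarrow> real" where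
  "causal_input Q xs zs = (\<Prod>i<length xs. pmf (Q (take i xs) (take i zs)) (xs ! i))"

text \<open>
  In the next definition \<open>ss\<close> lists the states after the initial state \<open>s0\<close>, so that
  \<open>(s0 # ss) ! i\<close> is the state preceding \<open>ss ! i\<close>.
\<close>

definition causal_output ::
  "'s pmf \<Rightarrow> ('x \<Rightarrow> 's::finite \<Rightarrow> ('y \<times> 's) pmf) \<Rightarrow> 'y list \<Rightarrow> 'x list \<Rightarrow> real" where
  "causal_output p0 K ys xs =
     (\<Sum>s0\<in>UNIV. pmf p0 s0 *
        (\<Sum>ss | length ss = length xs.
           \<Prod>i<length xs. pmf (K (xs ! i) ((s0 # ss) ! i)) (ys ! i, ss ! i)))"

text \<open>
  Joint law of the first \<open>n\<close> outputs and the current state when the encoder uses the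
  code-tree \<open>t\<close> and sees the feedback \<open>map z ys\<close> of the past outputs \<open>ys\<close>.
\<close>

primrec fsc_run ::
  "'s pmf \<Rightarrow> ('x \<Rightarrow> 's \<Rightarrow> ('y \<times> 's) pmf) \<Rightarrow> ('y \<Rightarrow> 'z) \<Rightarrow> ('z, 'x) code_tree \<Rightarrow> nat
     \<Rightarrow> ('y list \<times> 's) pmf" where
  "fsc_run p0 K z t 0 = map_pmf (\<lambda>s. ([], s)) p0"
| "fsc_run p0 K z t (Suc n) =
     bind_pmf (fsc_run p0 K z t n)
       (\<lambda>(ys, s). map_pmf (\<lambda>(y, s'). (ys @ [y], s')) (K (t (map z ys)) s))"

definition output_pmf ::
  "'s pmf \<Rightarrow> ('x \<Rightarrow> 's \<Rightarrow> ('y \<times> 's) pmf) \<Rightarrow> ('y \<Rightarrow> 'z) \<Rightarrow> nat \<Rightarrow> ('z, 'x) code_tree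
     \<Rightarrow> 'y list pmf" where
  "output_pmf p0 K z N t = map_pmf fst (fsc_run p0 K z t N)"

definition tree_path :: "('z, 'x) code_tree \<Rightarrow> 'z list \<Rightarrow> 'x list" where
  "tree_path t zs = map (\<lambda>i. t (take i zs)) [0..<length zs]"

text \<open>
  Given the first \<open>n\<close> levels of the tree, the symbols at level \<open>n + 1\<close> are drawn
  independently over all feedback histories \<open>zs\<close> of length \<open>n\<close>, the one at \<open>zs\<close> from
  \<open>Q\<close> conditioned on the path already chosen along \<open>zs\<close>. Levels not yet drawn carry the
  dummy value \<open>undefined\<close>.
\<close>

primrec random_tree ::
  "('x list \<Rightarrow> 'z list \<Rightarrow> 'x pmf) \<Rightarrow> nat \<Rightarrow> ('z, 'x) code_tree pmf" where
  "random_tree Q 0 = return_pmf (\<lambda>_. undefined)"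
| "random_tree Q (Suc n) =
     bind_pmf (random_tree Q n)
       (\<lambda>t. map_pmf (\<lambda>f zs. if length zs = n then f zs else t zs)
          (Pi_pmf {zs. length zs = n} undefined (\<lambda>zs. Q (tree_path t zs) zs)))"

definition random_code ::
  "('x list \<Rightarrow> 'z list \<Rightarrow> 'x pmf) \<Rightarrow> nat \<Rightarrow> nat \<Rightarrow> ('z, 'x) code pmf" where
  "random_code Q M N = Pi_pmf {1..M} (\<lambda>_. undefined) (\<lambda>_. random_tree Q N)"

text \<open>A decoder takes the code as an argument since it knows the code. Ties are broken
  arbitrarily.\<close>

definition ml_decoder ::
  "'s pmf \<Rightarrow> ('x \<Rightarrow> 's \<Rightarrow> ('y \<times> 's) pmf) \<Rightarrow> ('y \<Rightarrow> 'z) \<Rightarrow> nat \<Rightarrow> nat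
     \<Rightarrow> (('z, 'x) code \<Rightarrow> 'y list \<Rightarrow> nat) \<Rightarrow> bool" where
  "ml_decoder p0 K z M N dec \<longleftrightarrow>
     (\<forall>c ys. length ys = N \<longrightarrow>
        dec c ys \<in> {1..M} \<and>
        (\<forall>m\<in>{1..M}. pmf (output_pmf p0 K z N (c m)) ys
                     \<le> pmf (output_pmf p0 K z N (c (dec c ys))) ys))"

definition error_prob ::
  "'s pmf \<Rightarrow> ('x \<Rightarrow> 's \<Rightarrow> ('y \<times> 's) pmf) \<Rightarrow> ('y \<Rightarrow> 'z) \<Rightarrow> nat
     \<Rightarrow> (('z, 'x) code \<Rightarrow> 'y list \<Rightarrow> nat) \<Rightarrow> ('z, 'x) code \<Rightarrow> nat \<Rightarrow> real" where
  "error_prob p0 K z N dec c m =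
     (\<Sum>ys | length ys = N \<and> dec c ys \<noteq> m. pmf (output_pmf p0 K z N (c m)) ys)"

end

theory Submission
  imports Defs
begin

text \<open>
  This is Gallager's random coding argument. For output \<open>ys\<close> write \<open>W j\<close> for the likelihood of
  the \<open>j\<close>-th code-tree. An error requires \<open>W m \<le> W j\<close> for some \<open>j \<noteq> m\<close>, so with
  \<open>s = 1 / (1 + \<rho>)\<close> its probability is at most
  \<open>W m * (\<Sum>j \<noteq> m. (W j / W m) powr s) powr \<rho> = W m powr s * (\<Sum>j \<noteq> m. W j powr s) powr \<rho>\<close>.
  The trees are independent, so the expectation factors, and concavity of \<open>\<lambda>u. u powr \<rho>\<close> moves
  the expectation inside the second factor. Feedback only enters through two facts: the
  likelihood of \<open>ys\<close> depends on a tree only through its path along \<open>map z ys\<close>, and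
  along any fixed feedback sequence the path of the random tree has law \<open>causal_input Q\<close>.
\<close>

section \<open>Lists of fixed length and marginals\<close>

lemma finite_lists_of_length: "finite {xs :: 'a::finite list. length xs = n}"
  using finite_lists_length_eq[of "UNIV :: 'a set" n] by simp

lemma sum_lists_length_Suc:
  fixes f :: "'a::finite list \<Rightarrow> 'b::comm_monoid_add"
  shows "(\<Sum>xs | length xs = Suc n. f xs) = (\<Sum>xs | length xs = n. \<Sum>x\<in>UNIV. f (xs @ [x]))"
proof -
  have "(\<Sum>xs | length xs = n. \<Sum>x\<in>UNIV. f (xs @ [x]))
      = (\<Sum>(xs, x)\<in>{xs. length xs = n} \<times> UNIV. f (xs @ [x]))"
    by (rule sum.cartesian_product)
  also have "\<dots> = (\<Sum>xs | length xs = Suc n. f xs)"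
    by (rule sum.reindex_bij_witness[of _ "\<lambda>xs. (butlast xs, last xs)" "\<lambda>(xs, x). xs @ [x]"])
      (auto simp: length_Suc_conv_rev)
  finally show ?thesis ..
qed

lemma pmf_map_fst:
  fixes p :: "('a \<times> 'b::finite) pmf"
  shows "pmf (map_pmf fst p) a = (\<Sum>b\<in>UNIV. pmf p (a, b))"
proof -
  have "fst -` {a} = (\<lambda>b. (a, b)) ` (UNIV :: 'b set)"
    by auto
  then have "pmf (map_pmf fst p) a = measure p ((\<lambda>b. (a, b)) ` (UNIV :: 'b set))"
    by (simp add: pmf_map)
  also have "\<dots> = (\<Sum>b\<in>UNIV. pmf p (a, b))"
    by (subst measure_measure_pmf_finite) (auto simp: sum.reindex inj_on_def)
  finally show ?thesis .
qed

section \<open>Output law of a code-tree\<close>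

text \<open>A step only appends, so \<open>ys @ [y]\<close> fixes the earlier outputs and the bind
  reduces to a sum over the hidden previous state.\<close>

lemma pmf_fsc_run_snoc:
  fixes p0 :: "'s::finite pmf"
  shows "pmf (fsc_run p0 K z t (Suc n)) (ys @ [y], s') =
    (\<Sum>s\<in>UNIV. pmf (fsc_run p0 K z t n) (ys, s) * pmf (K (t (map z ys)) s) (y, s'))"
proof -
  let ?step = "\<lambda>(ys, s). map_pmf (\<lambda>(y, s'). (ys @ [y], s')) (K (t (map z ys)) s)"
  have step: "pmf (?step (ys, s)) (ys @ [y], s') = pmf (K (t (map z ys)) s) (y, s')" for s
  proof -
    have "inj (\<lambda>(y, s' :: 's). (ys @ [y], s'))"
      by (auto simp: inj_def)
    from pmf_map_inj'[OF this, of _ "(y, s')"] show ?thesis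
      by simp
  qed
  have "pmf (fsc_run p0 K z t (Suc n)) (ys @ [y], s')
      = (\<Sum>a\<in>Pair ys ` UNIV. pmf (?step a) (ys @ [y], s') * pmf (fsc_run p0 K z t n) a)"
    unfolding fsc_run.simps pmf_bind
    by (rule integral_measure_pmf_real) (auto simp: set_pmf_iff[symmetric])
  also have "\<dots> = (\<Sum>s\<in>UNIV. pmf (?step (ys, s)) (ys @ [y], s') * pmf (fsc_run p0 K z t n) (ys, s))"
    by (subst sum.reindex) (auto simp: inj_on_def)
  finally show ?thesis
    by (simp only: step mult.commute)
qed

text \<open>Testing against an arbitrary \<open>g\<close> on the final state makes the induction go through.\<close>

lemma sum_fsc_run:
  fixes p0 :: "'s::finite pmf" and ys :: "'y list" and g :: "'s \<Rightarrow> real"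
  assumes "length ys = n"
  shows "(\<Sum>s\<in>UNIV. pmf (fsc_run p0 K z t n) (ys, s) * g s) =
    (\<Sum>s0\<in>UNIV. pmf p0 s0 * (\<Sum>ss | length ss = n.
      (\<Prod>i<n. pmf (K (t (map z (take i ys))) ((s0 # ss) ! i)) (ys ! i, ss ! i)) * g (last (s0 # ss))))"
  using assms
proof (induction n arbitrary: ys g)
  case 0
  have "pmf (map_pmf (Pair ([] :: 'y list)) p0) ([], s) = pmf p0 s" for s
    by (rule pmf_map_inj') (auto simp: inj_def)
  with 0 show ?case
    by simp
next
  case (Suc n)
  from Suc.prems obtain us y where ys: "ys = us @ [y]" and us: "length us = n"
    by (auto simp: length_Suc_conv_rev)
  let ?k = "\<lambda>s s'. pmf (K (t (map z us)) s) (y, s')"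
  \<comment> \<open>With \<open>s0\<close> in front, the state before the new one is
    \<open>last (s0 # ss)\<close>, the argument at which the test function is evaluated.\<close>
  have prod_snoc: "(\<Prod>i<Suc n. pmf (K (t (map z (take i ys))) ((s0 # ss @ [s]) ! i)) (ys ! i, (ss @ [s]) ! i))
      = (\<Prod>i<n. pmf (K (t (map z (take i us))) ((s0 # ss) ! i)) (us ! i, ss ! i)) * ?k (last (s0 # ss)) s"
    if ss: "length ss = n" for s0 s ss
  proof -
    have "(s0 # ss @ [s]) ! n = last (s0 # ss)"
      using ss last_conv_nth[of "s0 # ss"] nth_append[of "s0 # ss" "[s]" n] by simp
    moreover have "(s0 # ss @ [s]) ! i = (s0 # ss) ! i" if "i < n" for i
      using ss that nth_append[of "s0 # ss" "[s]" i] by simp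
    ultimately show ?thesis
      using ss us by (simp add: ys nth_append)
  qed
  have "(\<Sum>s'\<in>UNIV. pmf (fsc_run p0 K z t (Suc n)) (ys, s') * g s')
      = (\<Sum>s'\<in>UNIV. \<Sum>s\<in>UNIV. pmf (fsc_run p0 K z t n) (us, s) * (?k s s' * g s'))"
    unfolding ys pmf_fsc_run_snoc by (simp add: sum_distrib_right mult.assoc)
  \<comment> \<open>The last transition is absorbed into a new test function of \<open>s\<close>, to
    which the induction hypothesis applies.\<close>
  also have "\<dots> = (\<Sum>s\<in>UNIV. pmf (fsc_run p0 K z t n) (us, s) * (\<Sum>s'\<in>UNIV. ?k s s' * g s'))"
    by (subst sum.swap) (simp add: sum_distrib_left)
  finally show ?case
    unfolding Suc.IH[OF us] sum_lists_length_Suc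
    by (auto intro!: sum.cong simp: prod_snoc sum_distrib_left mult.assoc simp del: prod.lessThan_Suc)
qed

text \<open>The constant test function 1 sums out the final state, and the inputs used along
  \<open>ys\<close> are exactly the entries of the tree path.\<close>

lemma pmf_output_pmf:
  fixes p0 :: "'s::finite pmf"
  assumes "length ys = N"
  shows "pmf (output_pmf p0 K z N t) ys = causal_output p0 K ys (tree_path t (map z ys))"
  using sum_fsc_run[OF assms, where g = "\<lambda>_. 1" and ?p0.0 = p0 and K = K and z = z and t = t] assms
  by (simp add: output_pmf_def pmf_map_fst causal_output_def tree_path_def take_map)

section \<open>Path law of the random tree\<close>

text \<open>Finite support makes every function of a random tree or code integrable.\<close>

lemma finite_set_random_tree:
  fixes Q :: "'x::finite list \<Rightarrow> 'z::finite list \<Rightarrow> 'x pmf"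
  shows "finite (set_pmf (random_tree Q n))"
  by (induction n) (auto simp: set_Pi_pmf finite_lists_of_length intro!: finite_imageI finite_PiE_dflt)

text \<open>Along a fixed feedback sequence each level contributes a single coordinate, whose
  marginal is \<open>Q\<close> given the path so far; this is the chain rule for
  \<open>causal_input\<close>.\<close>

lemma pmf_tree_path:
  fixes Q :: "'x::finite list \<Rightarrow> 'z::finite list \<Rightarrow> 'x pmf"
  assumes "length xs = n" "length zs = n"
  shows "pmf (map_pmf (\<lambda>t. tree_path t zs) (random_tree Q n)) xs = causal_input Q xs zs"
  using assms
proof (induction n arbitrary: xs zs)
  case 0
  then show ?case
    by (simp add: tree_path_def causal_input_def)
next
  case (Suc n)
  from Suc.prems obtain us x where xs: "xs = us @ [x]" and us: "length us = n"
    by (auto simp: length_Suc_conv_rev)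
  from Suc.prems obtain vs v where zs: "zs = vs @ [v]" and vs: "length vs = n"
    by (auto simp: length_Suc_conv_rev)
  let ?step = "\<lambda>us. map_pmf (\<lambda>x. us @ [x]) (Q us vs)"
  \<comment> \<open>Drawing level \<open>n\<close> leaves shorter histories untouched, and the last
    input is read at \<open>vs\<close>; the last feedback symbol \<open>v\<close> is never
    read.\<close>
  have path: "tree_path (\<lambda>zs. if length zs = n then f zs else t zs) zs = tree_path t vs @ [f vs]"
    for f t :: "('z, 'x) code_tree"
    using vs by (simp add: tree_path_def zs)
  have level: "map_pmf (\<lambda>f. us @ [f vs]) (Pi_pmf {zs. length zs = n} undefined (\<lambda>zs. Q (tree_path t zs) zs))
      = map_pmf (\<lambda>x. us @ [x]) (Q (tree_path t vs) vs)" for us t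
  proof -
    have "map_pmf (\<lambda>f. f vs) (Pi_pmf {zs. length zs = n} undefined (\<lambda>zs. Q (tree_path t zs) zs))
        = Q (tree_path t vs) vs"
      using vs by (simp add: Pi_pmf_component finite_lists_of_length)
    then show ?thesis
      using map_pmf_comp[of "\<lambda>x. us @ [x]" "\<lambda>f. f vs"] by metis
  qed
  have "map_pmf (\<lambda>t. tree_path t zs) (random_tree Q (Suc n))
      = bind_pmf (random_tree Q n) (\<lambda>t. ?step (tree_path t vs))"
    by (simp add: map_bind_pmf map_pmf_comp path level)
  also have "\<dots> = bind_pmf (map_pmf (\<lambda>t. tree_path t vs) (random_tree Q n)) ?step"
    by (simp add: bind_map_pmf)
  finally have "pmf (map_pmf (\<lambda>t. tree_path t zs) (random_tree Q (Suc n))) xs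
      = measure_pmf.expectation (map_pmf (\<lambda>t. tree_path t vs) (random_tree Q n))
          (\<lambda>us. pmf (?step us) xs)"
    by (simp only: pmf_bind)
  \<comment> \<open>Only the prefix \<open>us\<close> of \<open>xs\<close> can be extended to
    \<open>xs\<close>.\<close>
  also have "\<dots> = (\<Sum>ws\<in>{us}. pmf (?step ws) xs * pmf (map_pmf (\<lambda>t. tree_path t vs) (random_tree Q n)) ws)"
    by (rule integral_measure_pmf_real) (auto simp: set_pmf_iff[symmetric] xs)
  also have "\<dots> = pmf (Q us vs) x * causal_input Q us vs"
  proof -
    have "pmf (?step us) (us @ [x]) = pmf (Q us vs) x"
      by (rule pmf_map_inj') (auto simp: inj_def)
    then show ?thesis
      using Suc.IH[OF us vs] xs by simp
  qed
  also have "\<dots> = causal_input Q xs zs"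
    using us vs by (simp add: causal_input_def xs zs nth_append)
  finally show ?case .
qed

lemma expectation_tree_path:
  fixes Q :: "'x::finite list \<Rightarrow> 'z::finite list \<Rightarrow> 'x pmf" and g :: "'x list \<Rightarrow> real"
  assumes "length zs = n"
  shows "measure_pmf.expectation (random_tree Q n) (\<lambda>t. g (tree_path t zs))
    = (\<Sum>xs | length xs = n. causal_input Q xs zs * g xs)"
proof -
  let ?p = "map_pmf (\<lambda>t. tree_path t zs) (random_tree Q n)"
  have "measure_pmf.expectation (random_tree Q n) (\<lambda>t. g (tree_path t zs))
      = measure_pmf.expectation ?p g"
    by simp
  also have "\<dots> = (\<Sum>xs | length xs = n. g xs * pmf ?p xs)"
    using assms by (intro integral_measure_pmf_real) (auto simp: finite_lists_of_length tree_path_def)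
  finally show ?thesis
    using assms by (simp add: pmf_tree_path mult.commute)
qed

section \<open>Random coding bound\<close>

lemma expectation_pair_pmf_mult:
  fixes f :: "'a \<Rightarrow> real" and g :: "'b \<Rightarrow> real"
  assumes "finite (set_pmf p)" "finite (set_pmf q)"
  shows "measure_pmf.expectation (pair_pmf p q) (\<lambda>(a, b). f a * g b)
    = measure_pmf.expectation p f * measure_pmf.expectation q g"
proof -
  have "measure_pmf.expectation (pair_pmf p q) (\<lambda>(a, b). f a * g b)
      = (\<Sum>(a, b)\<in>set_pmf p \<times> set_pmf q. (f a * pmf p a) * (g b * pmf q b))"
    using assms
    by (subst integral_measure_pmf_real[of "set_pmf p \<times> set_pmf q"])
      (auto intro!: sum.cong simp: pmf_pair)
  then show ?thesis
    using assms
    by (simp add: integral_measure_pmf_real[of "set_pmf p"] integral_measure_pmf_real[of "set_pmf q"]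
        sum_product sum.cartesian_product)
qed

text \<open>Jensen's inequality for a concave power, obtained by integrating the tangent line at the
  mean \<open>a\<close>. The case \<open>a = 0\<close> is separate because the tangent divides by
  \<open>a\<close>.\<close>

lemma expectation_powr_le:
  fixes f :: "'a \<Rightarrow> real"
  assumes fin: "finite (set_pmf p)" and nonneg: "\<And>x. f x \<ge> 0" and \<rho>: "0 < \<rho>" "\<rho> \<le> 1"
  shows "measure_pmf.expectation p (\<lambda>x. f x powr \<rho>) \<le> measure_pmf.expectation p f powr \<rho>"
proof -
  define a where "a = measure_pmf.expectation p f"
  have int: "integrable (measure_pmf p) g" for g :: "'a \<Rightarrow> real"
    using fin by (rule integrable_measure_pmf_finite)
  have "a \<ge> 0"
    unfolding a_def using nonneg by (simp add: integral_nonneg_AE)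
  show ?thesis
  proof (cases "a = 0")
    case True
    then have "AE x in measure_pmf p. f x = 0"
      using integral_nonneg_eq_0_iff_AE[OF int, of f] nonneg by (simp add: a_def)
    then have "measure_pmf.expectation p (\<lambda>x. f x powr \<rho>) = measure_pmf.expectation p (\<lambda>_. 0)"
      by (intro integral_cong_AE) (auto elim: eventually_mono)
    then show ?thesis
      by simp
  next
    case False
    with \<open>a \<ge> 0\<close> have "a > 0"
      by simp
    \<comment> \<open>Young's inequality for \<open>f x / a\<close> and 1 with weights \<rho> and 1
      - \<rho>; the bracket has expectation 1.\<close>
    have tangent: "f x powr \<rho> \<le> a powr \<rho> * (\<rho> * (f x / a) + (1 - \<rho>))" for x
    proof (cases "f x = 0")
      case False
      with nonneg[of x] have "f x > 0"
        by simp
      then have "(f x / a) powr \<rho> * 1 powr (1 - \<rho>) \<le> \<rho> * (f x / a) + (1 - \<rho>) * 1"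
        using \<rho> \<open>a > 0\<close> by (intro Youngs_inequality_0) auto
      then have "a powr \<rho> * (f x / a) powr \<rho> \<le> a powr \<rho> * (\<rho> * (f x / a) + (1 - \<rho>))"
        by (intro mult_left_mono) auto
      then show ?thesis
        using \<open>f x > 0\<close> \<open>a > 0\<close> by (simp add: powr_divide)
    qed (use \<rho> in auto)
    have "measure_pmf.expectation p (\<lambda>x. f x powr \<rho>)
        \<le> measure_pmf.expectation p (\<lambda>x. a powr \<rho> * (\<rho> * (f x / a) + (1 - \<rho>)))"
      by (intro integral_mono int tangent)
    also have "\<dots> = a powr \<rho> * (\<rho> * (a / a) + (1 - \<rho>))"
      using int by (simp add: a_def)
    finally show ?thesis
      using \<open>a > 0\<close> by (simp add: a_def)
  qed
qed

lemma expectation_Pi_pmf_le: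
  fixes f :: "'b \<Rightarrow> real"
  assumes A: "finite A" "m \<in> A" and fin: "finite (set_pmf p)" and nonneg: "\<And>x. f x \<ge> 0"
    and \<rho>: "0 < \<rho>" "\<rho> \<le> 1"
  shows "measure_pmf.expectation (Pi_pmf A d (\<lambda>_. p)) (\<lambda>c. f (c m) * (\<Sum>j\<in>A - {m}. f (c j)) powr \<rho>)
    \<le> (real (card A) - 1) powr \<rho> * measure_pmf.expectation p f powr (1 + \<rho>)"
proof -
  let ?B = "A - {m}"
  let ?P = "Pi_pmf ?B d (\<lambda>_. p)"
  define a where "a = measure_pmf.expectation p f"
  have "a \<ge> 0"
    unfolding a_def using nonneg by (simp add: integral_nonneg_AE)
  have card: "card A \<ge> 1"
    using A card_gt_0_iff[of A] by auto
  have fin': "finite (set_pmf ?P)"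
    using A fin by (simp add: set_Pi_pmf finite_PiE_dflt)
  have component: "measure_pmf.expectation ?P (\<lambda>c. f (c j)) = a" if "j \<in> ?B" for j
  proof -
    have "measure_pmf.expectation ?P (\<lambda>c. f (c j))
        = measure_pmf.expectation (map_pmf (\<lambda>c. c j) ?P) f"
      by simp
    then show ?thesis
      using A that by (simp add: Pi_pmf_component a_def)
  qed
  have sum: "measure_pmf.expectation ?P (\<lambda>c. \<Sum>j\<in>?B. f (c j)) = (real (card A) - 1) * a"
    using A fin' card by (simp add: integrable_measure_pmf_finite component of_nat_diff)
  \<comment> \<open>Coordinate \<open>m\<close> is split off as an independent factor, so that the
    expectation of the product factors.\<close>
  have "Pi_pmf A d (\<lambda>_. p) = map_pmf (\<lambda>(x, c). c(m := x)) (pair_pmf p ?P)"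
    using A Pi_pmf_insert[of ?B m d "\<lambda>_. p"] by (simp add: insert_absorb)
  then have "measure_pmf.expectation (Pi_pmf A d (\<lambda>_. p)) (\<lambda>c. f (c m) * (\<Sum>j\<in>?B. f (c j)) powr \<rho>)
      = measure_pmf.expectation (pair_pmf p ?P) (\<lambda>(x, c). f x * (\<Sum>j\<in>?B. f (c j)) powr \<rho>)"
    by (auto simp: case_prod_unfold intro!: Bochner_Integration.integral_cong)
  also have "\<dots> = a * measure_pmf.expectation ?P (\<lambda>c. (\<Sum>j\<in>?B. f (c j)) powr \<rho>)"
    unfolding a_def by (rule expectation_pair_pmf_mult[OF fin fin'])
  also have "\<dots> \<le> a * measure_pmf.expectation ?P (\<lambda>c. \<Sum>j\<in>?B. f (c j)) powr \<rho>"
    using \<open>a \<ge> 0\<close> fin' nonneg \<rho>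
    by (intro mult_left_mono expectation_powr_le) (auto intro: sum_nonneg)
  also have "\<dots> = (real (card A) - 1) powr \<rho> * a powr (1 + \<rho>)"
    using \<open>a \<ge> 0\<close> card by (simp add: sum powr_mult powr_add)
  finally show ?thesis
    by (simp only: a_def)
qed

text \<open>With s = 1 / (1 + \<rho>), the exponent 1 splits as s + s \<rho>, and only the second
  factor is enlarged. No division by \<open>W m\<close> occurs, so zero likelihoods are
  covered.\<close>

lemma le_Gallager_bound:
  fixes W :: "'a \<Rightarrow> real"
  assumes "finite B" "j \<in> B" "\<And>i. W i \<ge> 0" "W m \<le> W j" "0 < \<rho>"
  shows "W m \<le> W m powr (1 / (1 + \<rho>)) * (\<Sum>i\<in>B. W i powr (1 / (1 + \<rho>))) powr \<rho>"
proof -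
  let ?s = "1 / (1 + \<rho>)"
  have "W m powr ?s \<le> W j powr ?s"
    using assms by (intro powr_mono2) auto
  also have "\<dots> \<le> (\<Sum>i\<in>B. W i powr ?s)"
    using assms by (intro member_le_sum) auto
  finally have "(W m powr ?s) powr \<rho> \<le> (\<Sum>i\<in>B. W i powr ?s) powr \<rho>"
    using assms by (intro powr_mono2) auto
  then have "W m powr ?s * (W m powr ?s) powr \<rho> \<le> W m powr ?s * (\<Sum>i\<in>B. W i powr ?s) powr \<rho>"
    by (intro mult_left_mono) auto
  moreover have "W m powr ?s * (W m powr ?s) powr \<rho> = W m"
  proof -
    have "?s + ?s * \<rho> = 1"
      using assms by (simp add: field_simps)
    then show ?thesis
      using assms(3)[of m] by (simp add: powr_powr powr_add[symmetric])
  qed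
  ultimately show ?thesis
    by simp
qed

text \<open>On an error the decoded message is the competitor \<open>j\<close>. Its likelihood is at
  least that of \<open>m\<close>, however ties are broken; the remaining outputs only add
  nonnegative terms.\<close>

lemma error_prob_le:
  fixes z :: "'y::finite \<Rightarrow> 'z"
  assumes dec: "ml_decoder p0 K z M N dec" and m: "m \<in> {1..M}" and \<rho>: "0 < \<rho>"
  shows "error_prob p0 K z N dec c m \<le> (\<Sum>ys | length ys = N.
    pmf (output_pmf p0 K z N (c m)) ys powr (1 / (1 + \<rho>)) *
    (\<Sum>j\<in>{1..M} - {m}. pmf (output_pmf p0 K z N (c j)) ys powr (1 / (1 + \<rho>))) powr \<rho>)"
  (is "_ \<le> (\<Sum>ys | _. ?b ys)")
proof -
  have "error_prob p0 K z N dec c m \<le> (\<Sum>ys | length ys = N \<and> dec c ys \<noteq> m. ?b ys)"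
    unfolding error_prob_def
  proof (rule sum_mono)
    fix ys assume "ys \<in> {ys. length ys = N \<and> dec c ys \<noteq> m}"
    with dec m show "pmf (output_pmf p0 K z N (c m)) ys \<le> ?b ys"
      by (intro le_Gallager_bound[where j = "dec c ys"
            and W = "\<lambda>j. pmf (output_pmf p0 K z N (c j)) ys"] \<rho>)
        (auto simp: ml_decoder_def)
  qed
  also have "\<dots> \<le> (\<Sum>ys | length ys = N. ?b ys)"
    by (rule sum_mono2) (auto simp: finite_lists_of_length)
  finally show ?thesis .
qed

theorem theorem8:
  fixes p0 :: "'s::finite pmf"
    and K :: "'x::finite \<Rightarrow> 's \<Rightarrow> ('y::finite \<times> 's) pmf"
    and z :: "'y \<Rightarrow> 'z::finite"
    and Q :: "'x list \<Rightarrow> 'z list \<Rightarrow> 'x pmf"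
    and dec :: "('z, 'x) code \<Rightarrow> 'y list \<Rightarrow> nat"
    and M N m :: nat and \<rho> :: real
  assumes "1 \<le> N"
    and "1 \<le> m" and "m \<le> M"
    and "ml_decoder p0 K z M N dec"
    and "0 < \<rho>" and "\<rho> \<le> 1"
  shows "measure_pmf.expectation (random_code Q M N) (\<lambda>c. error_prob p0 K z N dec c m)
    \<le> (real M - 1) powr \<rho> *
      (\<Sum>ys | length ys = N.
         (\<Sum>xs | length xs = N.
            causal_input Q xs (map z (take (N - 1) ys)) *
            causal_output p0 K ys xs powr (1 / (1 + \<rho>))) powr (1 + \<rho>))"
proof -
  let ?f = "\<lambda>ys t. pmf (output_pmf p0 K z N t) ys powr (1 / (1 + \<rho>))"
  have m: "m \<in> {1..M}"
    using assms by simp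
  have int: "integrable (measure_pmf (random_code Q M N)) g" for g :: "('z, 'x) code \<Rightarrow> real"
    unfolding random_code_def
    by (intro integrable_measure_pmf_finite)
      (simp add: set_Pi_pmf finite_PiE_dflt finite_set_random_tree)
  have tree: "measure_pmf.expectation (random_tree Q N) (?f ys)
      = (\<Sum>xs | length xs = N. causal_input Q xs (map z (take (N - 1) ys)) *
            causal_output p0 K ys xs powr (1 / (1 + \<rho>)))" if ys: "length ys = N" for ys
  proof -
    \<comment> \<open>The input at the last position depends on the first \<open>N - 1\<close>
      feedback symbols only.\<close>
    have "causal_input Q xs (map z ys) = causal_input Q xs (map z (take (N - 1) ys))"
      if "length xs = N" for xs
      using that by (auto simp: causal_input_def take_map intro!: prod.cong)
    then show ?thesis
      using expectation_tree_path[of "map z ys" N Q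
          "\<lambda>xs. causal_output p0 K ys xs powr (1 / (1 + \<rho>))"] ys
      by (simp add: pmf_output_pmf)
  qed
  have "measure_pmf.expectation (random_code Q M N) (\<lambda>c. error_prob p0 K z N dec c m)
      \<le> measure_pmf.expectation (random_code Q M N)
          (\<lambda>c. \<Sum>ys | length ys = N. ?f ys (c m) * (\<Sum>j\<in>{1..M} - {m}. ?f ys (c j)) powr \<rho>)"
    using assms m by (intro integral_mono int error_prob_le)
  also have "\<dots> = (\<Sum>ys | length ys = N. measure_pmf.expectation (random_code Q M N)
          (\<lambda>c. ?f ys (c m) * (\<Sum>j\<in>{1..M} - {m}. ?f ys (c j)) powr \<rho>))"
    by (intro Bochner_Integration.integral_sum int)
  \<comment> \<open>For each fixed output the likelihood power is a function of one tree, so the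
    bound for i.i.d. coordinates applies with \<open>M - 1\<close> competitors.\<close>
  also have "\<dots> \<le> (\<Sum>ys | length ys = N. (real M - 1) powr \<rho> *
          measure_pmf.expectation (random_tree Q N) (?f ys) powr (1 + \<rho>))"
    unfolding random_code_def
    using assms m expectation_Pi_pmf_le[of "{1..M}" m "random_tree Q N" "?f ys" \<rho> for ys]
    by (intro sum_mono) (simp add: finite_set_random_tree)
  also have "\<dots> = (real M - 1) powr \<rho> * (\<Sum>ys | length ys = N.
          measure_pmf.expectation (random_tree Q N) (?f ys) powr (1 + \<rho>))"
    by (simp only: sum_distrib_left)
  finally show ?thesis
    by (simp add: tree)
qed

end
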